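(* Let $n\ge2$, let $\mathcal H(s_1,\dots,s_n)$ be a rational function, and let $\mathbb L_n$ be the $n$-D Loewner matrix built from the evaluations of $\mathcal H$ at the column points $\lambda^{(l)}_j$ ($1\le j\le k_l$) and row points $\mu^{(l)}_i$ ($1\le i\le q_l$), $1\le l\le n$. Let $c_1^{(\lambda^{(2)}_{k_2},\dots,\lambda^{(n)}_{k_n})}\in\mathbb C^{k_1}$ span the null space of the 1-D Loewner matrix (in the variable $s_1$) obtained by freezing $s_2=\lambda^{(2)}_{k_2},\dots,s_n=\lambda^{(n)}_{k_n}$, and, for $j=1,\dots,k_1$, let $c_{n-1}^{\lambda^{(1)}_j}\in\mathbb C^{k_2\cdots k_n}$ span the null space of the $(n-1)$-D Loewner matrix (in the variables $s_2,\dots,s_n$) obtained by freezing $s_1=\lambda^{(1)}_j$, normalized so that its last entry equals $1$. Then the null space of $\mathbb L_n$ is spanned by the vector of $\mathbb C^{k_1k_2\cdots k_n}$ obtained by stacking $$\mathrm{vec}\Big[\,c_{n-1}^{\lambda^{(1)}_1}\cdot\big[c_1^{(\lambda^{(2)}_{k_2},\dots,\lambda^{(n)}_{k_n})}\big]_1,\;\dots,\;c_{n-1}^{\lambda^{(1)}_{k_1}}\cdot\big[c_1^{(\lambda^{(2)}_{k_2},\dots,\lambda^{(n)}_{k_n})}\big]_{k_1}\Big],$$ where $[\,\cdot\,]_j$ denotes the $j$-th entry.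
   Context: Data: for each $l$, the column points $\lambda^{(l)}_1,\dots,\lambda^{(l)}_{k_l}$ and row points $\mu^{(l)}_1,\dots,\mu^{(l)}_{q_l}$ are pairwise distinct complex numbers, and $\mathcal H$ is evaluated at every point whose $l$-th coordinate is one of these (for each $l$), including the mixed row/column points (the denominator of $\mathcal H$ is nonzero at all of them). Loewner matrices: given a function $G$ of $p$ variables with column points $\lambda^{(l)}_j$ and row points $\mu^{(l)}_i$ ($1\le l\le p$), its $p$-D Loewner matrix has, in row $(i_1,\dots,i_p)$ and column $(j_1,\dots,j_p)$ (multi-indices ordered lexicographically, last index fastest), the entry $$\frac{G(\mu^{(1)}_{i_1},\dots,\mu^{(p)}_{i_p})-G(\lambda^{(1)}_{j_1},\dots,\lambda^{(p)}_{j_p})}{\prod_{l=1}^p(\mu^{(l)}_{i_l}-\lambda^{(l)}_{j_l})}.$$ A Loewner matrix "for frozen" values of some variables is the Loewner matrix of the function obtained from $\mathcal H$ by fixing those variables at the given values, using the column/row points of the remaining variables. Standing assumptions: the number of interpolation points is appropriate, i.e. $k_l=d_l+1$, where $d_l$ is the degree of $\mathcal H$ in $s_l$ (the highest power of $s_l$ in numerator and denominator), and all Loewner matrices mentioned have one-dimensional null space. Here vec stacks the listed column vectors one below the other in the given order. *)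

theory Defs
  imports "Jordan_Normal_Form.Matrix_Kernel" "HOL-Library.Poly_Mapping"
begin

text \<open>
  Multivariate polynomials over the complex numbers, as finitely supported maps from exponent
  vectors to coefficients, with the convolution product of \<^theory>\<open>HOL-Library.Poly_Mapping\<close>.
  The variables are numbered from 0, and a point is the list of the values of the variables.
\<close>

type_synonym cmpoly = "(nat \<Rightarrow>\<^sub>0 nat) \<Rightarrow>\<^sub>0 complex"

definition mp_vars :: "cmpoly \<Rightarrow> nat set" where
  "mp_vars p = (\<Union>e\<in>Poly_Mapping.keys p. Poly_Mapping.keys e)"

definition mp_eval :: "cmpoly \<Rightarrow> complex list \<Rightarrow> complex" where
  "mp_eval p x = (\<Sum>e\<in>Poly_Mapping.keys p. Poly_Mapping.lookup p e * (\<Prod>l\<in>Poly_Mapping.keys e. x ! l ^ Poly_Mapping.lookup e l))"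

text \<open>The degree in a single variable; it is 0 for the zero polynomial.\<close>

definition mp_degree :: "nat \<Rightarrow> cmpoly \<Rightarrow> nat" where
  "mp_degree l p = Max (insert 0 ((\<lambda>e. Poly_Mapping.lookup e l) ` Poly_Mapping.keys p))"

text \<open>
  A rational function in \<open>n\<close> variables is given by a fraction in lowest terms, so that its degree
  in a variable, read off from numerator and denominator, is well defined.
  (\<^const>\<open>coprime\<close> is not available for this polynomial type, hence it is unfolded.)
\<close>

definition reduced_fraction :: "nat \<Rightarrow> cmpoly \<Rightarrow> cmpoly \<Rightarrow> bool" where
  "reduced_fraction n N D \<longleftrightarrow>
     mp_vars N \<subseteq> {..<n} \<and> mp_vars D \<subseteq> {..<n} \<and> D \<noteq> 0 \<and>
     (\<forall>C. C dvd N \<longrightarrow> C dvd D \<longrightarrow> C dvd 1)"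

definition fraction_eval :: "cmpoly \<Rightarrow> cmpoly \<Rightarrow> complex list \<Rightarrow> complex" where
  "fraction_eval N D x = mp_eval N x / mp_eval D x"

definition fraction_degree :: "nat \<Rightarrow> cmpoly \<Rightarrow> cmpoly \<Rightarrow> nat" where
  "fraction_degree l N D = max (mp_degree l N) (mp_degree l D)"

text \<open>
  The Loewner matrix of a function \<open>G\<close> of \<open>length cpts\<close> variables, where \<open>cpts ! l\<close> and
  \<open>rpts ! l\<close> list the column and the row points of variable \<open>l\<close>. The list
  \<^term>\<open>product_lists cpts\<close> consists of all column tuples in lexicographic order of the positions,
  with the last coordinate running fastest; likewise for the rows.
\<close>

definition loewner ::
  "(complex list \<Rightarrow> complex) \<Rightarrow> complex list list \<Rightarrow> complex list list \<Rightarrow> complex mat" where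
  "loewner G cpts rpts =
     mat (length (product_lists rpts)) (length (product_lists cpts))
       (\<lambda>(i, j). let x = product_lists rpts ! i; y = product_lists cpts ! j
                 in (G x - G y) / (\<Prod>l<length cpts. x ! l - y ! l))"

definition spans_kernel :: "complex vec \<Rightarrow> complex mat \<Rightarrow> bool" where
  "spans_kernel v A \<longleftrightarrow> v \<in> carrier_vec (dim_col A) \<and>
     LinearCombinations.module.span class_ring (module_vec TYPE(complex) (dim_col A)) {v}
       = mat_kernel A"

definition stack_vecs :: "complex vec list \<Rightarrow> complex vec" where
  "stack_vecs vs = vec_of_list (concat (map list_of_vec vs))"

end

(* Let D be the denominator of H. If a polynomial P has degree less than the number of column points
   in each variable, Lagrange interpolation writes P(x) as a barycentric sum over the grid of column
   points. Applied to the numerator and to D at a row point x, this shows that the vector with entries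
   weight(y) * D(y), where y runs over the column grid, lies in the kernel of the Loewner matrix; the
   same holds when some of the variables are frozen. Since all these kernels are one-dimensional,
   every spanning vector is a multiple of the one just described. The weights factor over the
   variables, and the normalization of the last entries cancels D(lambda_j, last points), so the
   stacked vector is a nonzero multiple of the vector of the full problem. *)

theory Submission imports Defs "HOL-Computational_Algebra.Polynomial" begin

section \<open>Barycentric interpolation on a grid\<close>

text \<open>Since \<open>k\<close> is below the number of nodes, the \<open>k\<close>-th power
  coincides with its Lagrange interpolant on \<open>S\<close>. Dividing its value at
  \<open>x\<close> by the nodal product gives a partial fraction expansion.\<close>

lemma barycentric_power:
  fixes S :: "'a :: field set"
  assumes "finite S" "k < card S" "x \<notin> S"
  shows "(\<Sum>t\<in>S. t ^ k / (\<Prod>s\<in>S - {t}. t - s) / (x - t)) = x ^ k / (\<Prod>t\<in>S. x - t)"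
proof -
  \<comment> \<open>\<open>q\<close> is the Lagrange interpolant: the summand for \<open>t\<close>
    takes the value \<open>t ^ k\<close> at \<open>t\<close> and vanishes at all other
    nodes.\<close>
  define q where
    "q = (\<Sum>t\<in>S. Polynomial.smult (t ^ k / (\<Prod>s\<in>S - {t}. t - s)) (\<Prod>s\<in>S - {t}. [:- s, 1:]))"
  have q: "poly q u = (\<Sum>t\<in>S. t ^ k / (\<Prod>s\<in>S - {t}. t - s) * (\<Prod>s\<in>S - {t}. u - s))" for u
    by (simp add: q_def poly_sum poly_prod)
  have "q = monom 1 k"
  proof (rule poly_eqI_degree[of S])
    fix u assume u: "u \<in> S"
    have "poly q u = (\<Sum>t\<in>S. if t = u then u ^ k else 0)"
      unfolding q
    proof (rule sum.cong[OF refl])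
      fix t assume "t \<in> S"
      show "t ^ k / (\<Prod>s\<in>S - {t}. t - s) * (\<Prod>s\<in>S - {t}. u - s) = (if t = u then u ^ k else 0)"
        using u assms(1) by (cases "t = u") (auto simp: prod_zero_iff)
    qed
    then show "poly q u = poly (monom 1 k) u"
      using u assms(1) by (simp add: poly_monom)
  next
    have "degree q \<le> card S - 1"
      unfolding q_def
    proof (rule degree_sum_le[OF assms(1)])
      fix t assume "t \<in> S"
      have "degree (\<Prod>s\<in>S - {t}. [:- s, 1:]) \<le> (\<Sum>s\<in>S - {t}. degree [:- s, 1:])"
        using degree_prod_sum_le[of "S - {t}" "\<lambda>s. [:- s, 1:]"] assms(1) by (simp add: o_def)
      also have "\<dots> = card S - 1"
        using \<open>t \<in> S\<close> assms(1) by simp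
      finally show "degree (Polynomial.smult (t ^ k / (\<Prod>s\<in>S - {t}. t - s)) (\<Prod>s\<in>S - {t}. [:- s, 1:])) \<le> card S - 1"
        using degree_smult_le order_trans by blast
    qed
    then show "degree q < card S"
      using assms(2) by linarith
  qed (use assms(2) degree_monom_le[of "1::'a" k] in linarith)
  then have "x ^ k = (\<Sum>t\<in>S. t ^ k / (\<Prod>s\<in>S - {t}. t - s) * (\<Prod>s\<in>S - {t}. x - s))"
    using q[of x] by (simp add: poly_monom)
  also have "\<dots> = (\<Sum>t\<in>S. t ^ k / (\<Prod>s\<in>S - {t}. t - s) / (x - t)) * (\<Prod>t\<in>S. x - t)"
    unfolding sum_distrib_right
  proof (rule sum.cong[OF refl])
    fix t assume t: "t \<in> S"
    then have "(\<Prod>t\<in>S. x - t) = (x - t) * (\<Prod>s\<in>S - {t}. x - s)" and "x \<noteq> t"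
      using assms by (auto intro: prod.remove)
    then show "t ^ k / (\<Prod>s\<in>S - {t}. t - s) * (\<Prod>s\<in>S - {t}. x - s)
        = t ^ k / (\<Prod>s\<in>S - {t}. t - s) / (x - t) * (\<Prod>t\<in>S. x - t)"
      by simp
  qed
  finally have "(\<Sum>t\<in>S. t ^ k / (\<Prod>s\<in>S - {t}. t - s) / (x - t)) * (\<Prod>t\<in>S. x - t) = x ^ k"
    by (rule sym)
  moreover have "(\<Prod>t\<in>S. x - t) \<noteq> 0"
    using assms(1,3) by auto
  ultimately show ?thesis
    by (metis nonzero_eq_divide_eq)
qed

text \<open>Distributivity, by induction on the number of variables. It reduces interpolation on a
  grid to interpolation in one variable.\<close>

lemma sum_list_product_lists:
  fixes f :: "nat \<Rightarrow> 'b \<Rightarrow> 'a :: comm_semiring_1"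
  shows "(\<Sum>y\<leftarrow>product_lists cs. \<Prod>l<length cs. f l (y ! l)) = (\<Prod>l<length cs. \<Sum>t\<leftarrow>cs ! l. f l t)"
proof (induction cs arbitrary: f)
  case (Cons c cs)
  have "(\<Sum>y\<leftarrow>product_lists (c # cs). \<Prod>l<length (c # cs). f l (y ! l))
      = (\<Sum>t\<leftarrow>c. \<Sum>y\<leftarrow>product_lists cs. f 0 t * (\<Prod>l<length cs. f (Suc l) (y ! l)))"
    by (induction c) (simp_all add: prod.lessThan_Suc_shift o_def del: prod.lessThan_Suc)
  also have "\<dots> = (\<Sum>t\<leftarrow>c. f 0 t) * (\<Prod>l<length cs. \<Sum>t\<leftarrow>cs ! l. f (Suc l) t)"
    using Cons.IH[of "\<lambda>l. f (Suc l)"] by (simp add: sum_list_const_mult sum_list_mult_const)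
  finally show ?case
    by (simp add: prod.lessThan_Suc_shift del: prod.lessThan_Suc)
qed simp

lemma prod_nth_append:
  fixes g :: "nat \<Rightarrow> 'b \<Rightarrow> 'a :: comm_monoid_mult"
  shows "(\<Prod>l<length (xs @ ys). g l ((xs @ ys) ! l))
    = (\<Prod>l<length xs. g l (xs ! l)) * (\<Prod>l<length ys. g (length xs + l) (ys ! l))"
proof (induction xs arbitrary: g)
  case (Cons x xs)
  show ?case
    using Cons.IH[of "\<lambda>l. g (Suc l)"] by (simp add: prod.lessThan_Suc_shift mult.assoc del: prod.lessThan_Suc)
qed simp

text \<open>The tensor product of the barycentric weights of one-variable Lagrange interpolation.
  The value \<open>y ! l\<close> itself is removed from the nodes, so no factor of the denominators
  vanishes, whatever \<open>y\<close> is.\<close>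

definition bary_weight :: "complex list list \<Rightarrow> complex list \<Rightarrow> complex" where
  "bary_weight cs y = (\<Prod>l<length cs. 1 / (\<Prod>s\<in>set (cs ! l) - {y ! l}. y ! l - s))"

lemma bary_weight_nonzero: "bary_weight cs y \<noteq> 0"
  by (auto simp: bary_weight_def)

lemma bary_weight_Cons: "bary_weight (c # cs) (t # y) = bary_weight [c] [t] * bary_weight cs y"
  by (simp add: bary_weight_def prod.lessThan_Suc_shift del: prod.lessThan_Suc)

lemma product_lists_nth:
  assumes "y \<in> set (product_lists cs)"
  shows "length y = length cs" "l < length cs \<Longrightarrow> y ! l \<in> set (cs ! l)"
  using assms by (auto simp: product_lists_set list_all2_conv_all_nth)

lemma mp_degree_ge: "e \<in> Poly_Mapping.keys P \<Longrightarrow> Poly_Mapping.lookup e l \<le> mp_degree l P"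
  unfolding mp_degree_def by (intro Max_ge) auto

text \<open>By linearity a single monomial suffices; its powers separate over the variables, and
  \<open>barycentric_power\<close> applies to each free one. Frozen values on both sides,
  \<open>us\<close> and \<open>vs\<close>, let one statement cover the full matrix and both kinds of
  frozen ones.\<close>

lemma barycentric_mp_eval:
  assumes vars: "mp_vars P \<subseteq> {..<length us + length cs + length vs}"
    and dist: "\<And>l. l < length cs \<Longrightarrow> distinct (cs ! l)"
    and deg: "\<And>l. l < length cs \<Longrightarrow> mp_degree (length us + l) P < length (cs ! l)"
    and x: "length x = length cs" "\<And>l. l < length cs \<Longrightarrow> x ! l \<notin> set (cs ! l)"
  shows "(\<Sum>y\<leftarrow>product_lists cs. bary_weight cs y * mp_eval P (us @ y @ vs) / (\<Prod>l<length cs. x ! l - y ! l))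
    = mp_eval P (us @ x @ vs) / (\<Prod>l<length cs. \<Prod>t\<in>set (cs ! l). x ! l - t)"
proof -
  \<comment> \<open>\<open>C e\<close> gathers everything that is constant in the free variables.
    The \<open>l\<close>-th free variable is variable \<open>length us + l\<close> of
    \<open>P\<close>, hence the shift in \<open>ex\<close>.\<close>
  define C where "C e = Poly_Mapping.lookup P e * (\<Prod>l<length us. us ! l ^ Poly_Mapping.lookup e l) *
      (\<Prod>l<length vs. vs ! l ^ Poly_Mapping.lookup e (length us + length cs + l))" for e
  define ex where "ex e l = Poly_Mapping.lookup e (length us + l)" for e :: "nat \<Rightarrow>\<^sub>0 nat" and l
  have eval: "mp_eval P (us @ y @ vs) = (\<Sum>e\<in>Poly_Mapping.keys P. C e * (\<Prod>l<length cs. y ! l ^ ex e l))"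
    if "length y = length cs" for y
    unfolding mp_eval_def
  proof (rule sum.cong[OF refl])
    fix e assume e: "e \<in> Poly_Mapping.keys P"
    have "Poly_Mapping.keys e \<subseteq> {..<length (us @ y @ vs)}"
      using e vars that unfolding mp_vars_def by (simp add: UN_subset_iff add.assoc)
    \<comment> \<open>Variables outside \<open>keys e\<close> have exponent 0 and contribute factors
      1, so the product may run over all positions.\<close>
    then have "(\<Prod>l\<in>Poly_Mapping.keys e. (us @ y @ vs) ! l ^ Poly_Mapping.lookup e l)
        = (\<Prod>l<length (us @ y @ vs). (us @ y @ vs) ! l ^ Poly_Mapping.lookup e l)"
      by (intro prod.mono_neutral_left) (auto simp: in_keys_iff)
    also have "\<dots> = (\<Prod>l<length us. us ! l ^ Poly_Mapping.lookup e l) *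
        ((\<Prod>l<length cs. y ! l ^ ex e l) *
         (\<Prod>l<length vs. vs ! l ^ Poly_Mapping.lookup e (length us + length cs + l)))"
      unfolding prod_nth_append[of "\<lambda>l t. t ^ Poly_Mapping.lookup e l"]
        prod_nth_append[of "\<lambda>l t. t ^ Poly_Mapping.lookup e (length us + l)"]
      by (simp add: that ex_def add.assoc)
    finally show "Poly_Mapping.lookup P e * (\<Prod>l\<in>Poly_Mapping.keys e. (us @ y @ vs) ! l ^ Poly_Mapping.lookup e l)
        = C e * (\<Prod>l<length cs. y ! l ^ ex e l)"
      by (simp add: C_def mult_ac)
  qed
  have mono: "(\<Sum>y\<leftarrow>product_lists cs. bary_weight cs y * (\<Prod>l<length cs. y ! l ^ ex e l) / (\<Prod>l<length cs. x ! l - y ! l))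
      = (\<Prod>l<length cs. x ! l ^ ex e l) / (\<Prod>l<length cs. \<Prod>t\<in>set (cs ! l). x ! l - t)"
    if e: "e \<in> Poly_Mapping.keys P" for e
  proof -
    have "(\<Sum>y\<leftarrow>product_lists cs. bary_weight cs y * (\<Prod>l<length cs. y ! l ^ ex e l) / (\<Prod>l<length cs. x ! l - y ! l))
        = (\<Sum>y\<leftarrow>product_lists cs. \<Prod>l<length cs. y ! l ^ ex e l / (\<Prod>s\<in>set (cs ! l) - {y ! l}. y ! l - s) / (x ! l - y ! l))"
      by (simp add: bary_weight_def prod_dividef prod.distrib)
    also have "\<dots> = (\<Prod>l<length cs. \<Sum>t\<leftarrow>cs ! l. t ^ ex e l / (\<Prod>s\<in>set (cs ! l) - {t}. t - s) / (x ! l - t))"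
      by (rule sum_list_product_lists)
    also have "\<dots> = (\<Prod>l<length cs. x ! l ^ ex e l / (\<Prod>t\<in>set (cs ! l). x ! l - t))"
    proof (rule prod.cong[OF refl])
      fix l assume l: "l \<in> {..<length cs}"
      \<comment> \<open>Distinctness turns the length of the node list into the cardinality of its
        set, and each exponent is at most the degree in its variable.\<close>
      then have "ex e l < card (set (cs ! l))"
        using mp_degree_ge[OF e, of "length us + l"] deg[of l] dist[of l]
        by (simp add: distinct_card ex_def)
      then show "(\<Sum>t\<leftarrow>cs ! l. t ^ ex e l / (\<Prod>s\<in>set (cs ! l) - {t}. t - s) / (x ! l - t))
          = x ! l ^ ex e l / (\<Prod>t\<in>set (cs ! l). x ! l - t)"
        using l dist[of l] x(2)[of l] barycentric_power[of "set (cs ! l)" "ex e l" "x ! l"]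
        by (simp add: sum_list_distinct_conv_sum_set)
    qed
    finally show ?thesis
      by (simp add: prod_dividef)
  qed
  have "(\<Sum>y\<leftarrow>product_lists cs. bary_weight cs y * mp_eval P (us @ y @ vs) / (\<Prod>l<length cs. x ! l - y ! l))
      = (\<Sum>y\<leftarrow>product_lists cs. \<Sum>e\<in>Poly_Mapping.keys P.
          C e * (bary_weight cs y * (\<Prod>l<length cs. y ! l ^ ex e l) / (\<Prod>l<length cs. x ! l - y ! l)))"
  proof (intro arg_cong[of _ _ sum_list] map_cong refl)
    fix y assume "y \<in> set (product_lists cs)"
    then show "bary_weight cs y * mp_eval P (us @ y @ vs) / (\<Prod>l<length cs. x ! l - y ! l)
        = (\<Sum>e\<in>Poly_Mapping.keys P.
          C e * (bary_weight cs y * (\<Prod>l<length cs. y ! l ^ ex e l) / (\<Prod>l<length cs. x ! l - y ! l)))"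
      by (simp add: eval product_lists_nth sum_distrib_left sum_divide_distrib mult_ac)
  qed
  also have "\<dots> = (\<Sum>e\<in>Poly_Mapping.keys P. \<Sum>y\<leftarrow>product_lists cs.
          C e * (bary_weight cs y * (\<Prod>l<length cs. y ! l ^ ex e l) / (\<Prod>l<length cs. x ! l - y ! l)))"
    by (simp add: sum_list_sum_nth sum.swap[of _ "Poly_Mapping.keys P"])
  also have "\<dots> = (\<Sum>e\<in>Poly_Mapping.keys P.
      C e * ((\<Prod>l<length cs. x ! l ^ ex e l) / (\<Prod>l<length cs. \<Prod>t\<in>set (cs ! l). x ! l - t)))"
    unfolding sum_list_const_mult by (simp add: mono)
  also have "\<dots> = mp_eval P (us @ x @ vs) / (\<Prod>l<length cs. \<Prod>t\<in>set (cs ! l). x ! l - t)"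
    by (simp add: eval x(1) sum_divide_distrib)
  finally show ?thesis .
qed

section \<open>Explicit null vectors of Loewner matrices\<close>

text \<open>The entries follow the column order of \<open>loewner\<close>. \<open>F\<close> will be
  the denominator as a function of the free variables.\<close>

definition bary_vec :: "(complex list \<Rightarrow> complex) \<Rightarrow> complex list list \<Rightarrow> complex vec" where
  "bary_vec F cs = vec_of_list (map (\<lambda>y. bary_weight cs y * F y) (product_lists cs))"

text \<open>The factor \<open>D(y)\<close> clears the denominator of \<open>G(y)\<close>:
  \<open>(G(x) - G(y)) * D(y) = G(x) * D(y) - N(y)\<close>. Interpolating \<open>D\<close> and
  \<open>N\<close> at the row point \<open>x\<close> turns the row sum into a multiple of
  \<open>G(x) * D(x) - N(x)\<close>, which is 0.\<close>

lemma bary_vec_in_kernel_loewner: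
  assumes vars: "mp_vars N \<subseteq> {..<length us + length cs + length vs}" "mp_vars D \<subseteq> {..<length us + length cs + length vs}"
    and len: "length rs = length cs"
    and dist: "\<And>l. l < length cs \<Longrightarrow> distinct (cs ! l @ rs ! l)"
    and deg: "\<And>l. l < length cs \<Longrightarrow> fraction_degree (length us + l) N D < length (cs ! l)"
    and nz: "\<And>x. x \<in> set (product_lists cs) \<union> set (product_lists rs) \<Longrightarrow> mp_eval D (us @ x @ vs) \<noteq> 0"
  shows "bary_vec (\<lambda>y. mp_eval D (us @ y @ vs)) cs \<in> mat_kernel (loewner (\<lambda>x. fraction_eval N D (us @ x @ vs)) cs rs)"
    (is "?v \<in> mat_kernel ?L")
proof (rule mat_kernelI)
  show L: "?L \<in> carrier_mat (length (product_lists rs)) (length (product_lists cs))"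
    by (simp add: loewner_def)
  show "?v \<in> carrier_vec (length (product_lists cs))"
    by (simp add: bary_vec_def carrier_vecI del: vec_of_list_map)
  show "?L *\<^sub>v ?v = 0\<^sub>v (length (product_lists rs))"
  proof (rule eq_vecI)
    fix i assume "i < dim_vec (0\<^sub>v (length (product_lists rs)) :: complex vec)"
    then have i: "i < length (product_lists rs)" by simp
    define x where "x = product_lists rs ! i"
    have x: "x \<in> set (product_lists rs)"
      using i by (simp add: x_def)
    \<comment> \<open>The nodal product is the same for \<open>N\<close> and \<open>D\<close>, so
      the two interpolation identities can be combined.\<close>
    define K where "K = (\<Prod>l<length cs. \<Prod>t\<in>set (cs ! l). x ! l - t)"
    have bary: "(\<Sum>y\<leftarrow>product_lists cs. bary_weight cs y * mp_eval P (us @ y @ vs) / (\<Prod>l<length cs. x ! l - y ! l))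
        = mp_eval P (us @ x @ vs) / K" if "P = N \<or> P = D" for P
      unfolding K_def
    proof (rule barycentric_mp_eval)
      show "mp_vars P \<subseteq> {..<length us + length cs + length vs}"
        using vars that by auto
      show "length x = length cs"
        using x len by (simp add: product_lists_nth)
      fix l assume l: "l < length cs"
      show "distinct (cs ! l)" "mp_degree (length us + l) P < length (cs ! l)"
        using dist[OF l] deg[OF l] that by (auto simp: fraction_degree_def)
      show "x ! l \<notin> set (cs ! l)"
        using dist[OF l] product_lists_nth(2)[OF x, of l] l len by auto
    qed
    let ?G = "\<lambda>x. fraction_eval N D (us @ x @ vs)" and ?d = "\<lambda>y. \<Prod>l<length cs. x ! l - y ! l"
    have "(?L *\<^sub>v ?v) $ i = (\<Sum>y\<leftarrow>product_lists cs. (?G x - ?G y) / ?d y * (bary_weight cs y * mp_eval D (us @ y @ vs)))"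
      using i by (simp add: loewner_def bary_vec_def scalar_prod_def Let_def sum_list_sum_nth x_def
          vec_of_list_index del: vec_of_list_map)
    also have "\<dots> = (\<Sum>y\<leftarrow>product_lists cs. ?G x * (bary_weight cs y * mp_eval D (us @ y @ vs) / ?d y)
        - bary_weight cs y * mp_eval N (us @ y @ vs) / ?d y)"
    proof (intro arg_cong[of _ _ sum_list] map_cong refl)
      fix y assume "y \<in> set (product_lists cs)"
      then have "mp_eval D (us @ y @ vs) \<noteq> 0" using nz by simp
      then have "?G y * mp_eval D (us @ y @ vs) = mp_eval N (us @ y @ vs)"
        by (simp add: fraction_eval_def)
      then show "(?G x - ?G y) / ?d y * (bary_weight cs y * mp_eval D (us @ y @ vs))
          = ?G x * (bary_weight cs y * mp_eval D (us @ y @ vs) / ?d y)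
            - bary_weight cs y * mp_eval N (us @ y @ vs) / ?d y"
        by (simp add: diff_divide_distrib algebra_simps)
    qed
    also have "\<dots> = ?G x * (mp_eval D (us @ x @ vs) / K) - mp_eval N (us @ x @ vs) / K"
      unfolding sum_list_subtractf sum_list_const_mult by (simp add: bary)
    also have "\<dots> = 0"
      using nz[of x] x by (simp add: fraction_eval_def)
    finally show "(?L *\<^sub>v ?v) $ i = 0\<^sub>v (length (product_lists rs)) $ i"
      using i by simp
  qed (simp add: loewner_def)
qed

section \<open>Generators of one-dimensional kernels\<close>

lemma span_singleton_vec:
  fixes v :: "complex vec"
  assumes "v \<in> carrier_vec n"
  shows "LinearCombinations.module.span class_ring (module_vec TYPE(complex) n) {v} = range (\<lambda>a. a \<cdot>\<^sub>v v)"
proof -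
  interpret vec_space "TYPE(complex)" n .
  show ?thesis
    using assms by (subst finite_span) (auto simp: lincomb_def)
qed

text \<open>The row echelon form differs from \<open>A\<close> by an invertible left factor, so it
  has the same kernel, and it comes with an explicit finite basis of that kernel. Dimension one
  leaves a single basis vector.\<close>

lemma mat_kernel_dim_one:
  fixes A :: "complex mat"
  assumes "kernel_dim A = 1"
  obtains b where "b \<in> carrier_vec (dim_col A)" "mat_kernel A = range (\<lambda>a. a \<cdot>\<^sub>v b)"
proof -
  let ?B = "gauss_jordan_single A"
  have A: "A \<in> carrier_mat (dim_row A) (dim_col A)" by simp
  from gauss_jordan_single[OF A refl]
  obtain P Q where B: "?B = P * A" "Q * P = 1\<^sub>m (dim_row A)"
      "P \<in> carrier_mat (dim_row A) (dim_row A)" "Q \<in> carrier_mat (dim_row A) (dim_row A)"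
      "?B \<in> carrier_mat (dim_row A) (dim_col A)" "row_echelon_form ?B"
    by auto
  interpret K: kernel "dim_row A" "dim_col A" ?B
    by unfold_locales (rule B(5))
  have ker: "mat_kernel ?B = mat_kernel A"
    using mat_kernel_mult_eq[OF A B(3,4,2)] B(1) by simp
  have "K.dim = 1"
    using assms ker B(5) unfolding kernel_dim_def by simp
  moreover have basis: "K.basis (set (find_base_vectors ?B))"
    using find_base_vectors[OF B(6,5)] by simp
  ultimately obtain b where "set (find_base_vectors ?B) = {b}"
    using K.Ker.dim_basis[OF _ basis] by (auto simp: card_1_singleton_iff)
  with basis have b: "b \<in> mat_kernel ?B" "K.span {b} = mat_kernel ?B"
    by (auto simp: K.Ker.basis_def)
  then have "b \<in> carrier_vec (dim_col A)"
    using mat_kernelD(1)[OF B(5)] by simp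
  with that show thesis
    using b K.span_same[of "{b}"] ker by (simp add: span_singleton_vec)
qed

text \<open>On the line through \<open>b\<close>, a nonzero \<open>v\<close> is \<open>b\<close>
  times some nonzero \<open>a\<close>; scaling by \<open>inverse a\<close> recovers all multiples of
  \<open>b\<close>.\<close>

lemma spans_kernelI:
  assumes "kernel_dim A = 1" "v \<in> mat_kernel A" "v \<noteq> 0\<^sub>v (dim_col A)"
  shows "spans_kernel v A"
proof -
  obtain b where b: "b \<in> carrier_vec (dim_col A)" "mat_kernel A = range (\<lambda>a. a \<cdot>\<^sub>v b)"
    using mat_kernel_dim_one[OF assms(1)] .
  then obtain a where a: "v = a \<cdot>\<^sub>v b"
    using assms(2) by auto
  then have "a \<noteq> 0"
    using assms(3) b(1) by (auto intro!: eq_vecI)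
  then have "(k * inverse a) \<cdot>\<^sub>v v = k \<cdot>\<^sub>v b" for k
    by (simp add: a smult_smult_assoc mult.assoc)
  then have "range (\<lambda>k. k \<cdot>\<^sub>v b) \<subseteq> range (\<lambda>k. k \<cdot>\<^sub>v v)"
    by (metis image_subsetI rangeI)
  moreover have "range (\<lambda>k. k \<cdot>\<^sub>v v) \<subseteq> range (\<lambda>k. k \<cdot>\<^sub>v b)"
    by (auto simp: a smult_smult_assoc)
  moreover have "v \<in> carrier_vec (dim_col A)"
    using a b(1) by simp
  ultimately show ?thesis
    by (simp add: spans_kernel_def span_singleton_vec b(2))
qed

text \<open>Compares a given generator with an explicit null vector: \<open>v\<close> is a multiple
  of \<open>c\<close> by some nonzero \<open>b\<close>, and \<open>inverse b\<close> is the required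
  factor.\<close>

lemma spans_kernel_smult:
  assumes "spans_kernel c A" "v \<in> mat_kernel A" "v \<noteq> 0\<^sub>v (dim_col A)"
  obtains a where "a \<noteq> 0" "c = a \<cdot>\<^sub>v v"
proof -
  have c: "c \<in> carrier_vec (dim_col A)" "mat_kernel A = range (\<lambda>k. k \<cdot>\<^sub>v c)"
    using assms(1) by (auto simp: spans_kernel_def span_singleton_vec)
  then obtain b where b: "v = b \<cdot>\<^sub>v c"
    using assms(2) by auto
  then have "b \<noteq> 0"
    using assms(3) c(1) by (auto intro!: eq_vecI)
  with b that[of "inverse b"] show thesis
    by (simp add: smult_smult_assoc)
qed

section \<open>Entries and blocks of the barycentric vector\<close>

text \<open>The weights never vanish, so one grid point with a nonzero value of \<open>F\<close>
  suffices.\<close>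

lemma bary_vec_nonzero:
  assumes "y \<in> set (product_lists cs)" "F y \<noteq> 0"
  shows "bary_vec F cs \<noteq> 0\<^sub>v (length (product_lists cs))"
proof
  assume eq: "bary_vec F cs = 0\<^sub>v (length (product_lists cs))"
  obtain i where "i < length (product_lists cs)" "y = product_lists cs ! i"
    using assms(1) by (auto simp: in_set_conv_nth)
  then have "bary_vec F cs $ i = bary_weight cs y * F y"
    by (simp add: bary_vec_def vec_of_list_index del: vec_of_list_map)
  then show False
    using assms(2) \<open>i < _\<close> by (simp add: eq bary_weight_nonzero)
qed

lemma dim_col_loewner [simp]: "dim_col (loewner G cs rs) = length (product_lists cs)"
  by (simp add: loewner_def)

lemma last_product_lists:
  assumes "[] \<notin> set cs"
  shows "product_lists cs \<noteq> [] \<and> last (product_lists cs) = map last cs"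
  using assms
proof (induction cs)
  case (Cons c cs)
  then have IH: "product_lists cs \<noteq> []" "last (product_lists cs) = map last cs" and "c \<noteq> []"
    by auto
  \<comment> \<open>The tuples starting with the last element \<open>t\<close> of \<open>c\<close>
    form the final block of the product list.\<close>
  then obtain c' t where c: "c = c' @ [t]"
    using rev_exhaust by blast
  show ?case
    using IH by (simp add: c last_map)
qed simp

text \<open>This entry is the one normalized to 1. Its grid point is also where the one-variable
  problem freezes the other variables, so the same value of \<open>F\<close> occurs in both.\<close>

lemma bary_vec_last:
  assumes "[] \<notin> set cs"
  shows "bary_vec F cs $ (length (product_lists cs) - 1) = bary_weight cs (map last cs) * F (map last cs)"
  using last_product_lists[OF assms] last_conv_nth[of "product_lists cs"]
  by (simp add: bary_vec_def vec_of_list_index del: vec_of_list_map)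

text \<open>Fixing the first coordinate cuts the grid of \<open>c # cs\<close> into consecutive
  blocks, and by \<open>bary_weight_Cons\<close> the weight of that coordinate is a common factor of
  its block.\<close>

lemma stack_bary_vec:
  "stack_vecs (map (\<lambda>j. (a * bary_weight [c] [c ! j]) \<cdot>\<^sub>v bary_vec (\<lambda>y. F (c ! j # y)) cs) [0..<length c])
    = a \<cdot>\<^sub>v bary_vec F (c # cs)"
proof -
  have smult: "k \<cdot>\<^sub>v vec_of_list xs = vec_of_list (map ((*) k) xs)" for k :: complex and xs
    by (intro eq_vecI) (simp_all add: vec_of_list_index del: vec_of_list_map)
  let ?f = "\<lambda>t. map (\<lambda>y. a * (bary_weight (c # cs) (t # y) * F (t # y))) (product_lists cs)"
  have "map (\<lambda>j. list_of_vec ((a * bary_weight [c] [c ! j]) \<cdot>\<^sub>v bary_vec (\<lambda>y. F (c ! j # y)) cs)) [0..<length c]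
      = map (\<lambda>j. ?f (c ! j)) [0..<length c]"
    by (simp add: bary_vec_def smult list_vec bary_weight_Cons[of c cs] o_def mult.assoc del: vec_of_list_map)
  also have "\<dots> = map ?f (map ((!) c) [0..<length c])"
    by (simp only: map_map o_def)
  also have "\<dots> = map ?f c"
    by (simp only: map_nth)
  finally show ?thesis
    by (simp add: stack_vecs_def bary_vec_def smult map_concat o_def del: vec_of_list_map)
qed

section \<open>Assembling the null vector of the full matrix\<close>

theorem theorem5p3:
  fixes n :: nat
    and N D :: cmpoly
    and H :: "complex list \<Rightarrow> complex"
    and cpts rpts :: "complex list list"
    and c1 :: "complex vec"
    and c :: "nat \<Rightarrow> complex vec"
  assumes "n \<ge> 2"
    and "reduced_fraction n N D"
    and "H = fraction_eval N D"
    and "length cpts = n" and "length rpts = n"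
    and "\<And>l. l < n \<Longrightarrow> distinct (cpts ! l @ rpts ! l)"
    and "\<And>x. length x = n \<Longrightarrow> (\<And>l. l < n \<Longrightarrow> x ! l \<in> set (cpts ! l) \<union> set (rpts ! l))
           \<Longrightarrow> mp_eval D x \<noteq> 0"
    and "\<And>l. l < n \<Longrightarrow> length (cpts ! l) = fraction_degree l N D + 1"
    and "kernel_dim (loewner H cpts rpts) = 1"
    and "kernel_dim (loewner (\<lambda>x. H (x @ map last (tl cpts))) [cpts ! 0] [rpts ! 0]) = 1"
    and "\<And>j. j < length (cpts ! 0) \<Longrightarrow>
           kernel_dim (loewner (\<lambda>x. H ((cpts ! 0 ! j) # x)) (tl cpts) (tl rpts)) = 1"
    and "spans_kernel c1 (loewner (\<lambda>x. H (x @ map last (tl cpts))) [cpts ! 0] [rpts ! 0])"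
    and "\<And>j. j < length (cpts ! 0) \<Longrightarrow>
           spans_kernel (c j) (loewner (\<lambda>x. H ((cpts ! 0 ! j) # x)) (tl cpts) (tl rpts))"
    and "\<And>j. j < length (cpts ! 0) \<Longrightarrow> c j $ (dim_vec (c j) - 1) = 1"
  shows "spans_kernel
           (stack_vecs (map (\<lambda>j. (c1 $ j) \<cdot>\<^sub>v c j) [0..<length (cpts ! 0)]))
           (loewner H cpts rpts)"
proof -
  define c0 cs r0 rs where "c0 = cpts ! 0" and "cs = tl cpts" and "r0 = rpts ! 0" and "rs = tl rpts"
  have cpts: "cpts = c0 # cs" and rpts: "rpts = r0 # rs"
    using assms(1,4,5) by (cases cpts; cases rpts; simp add: c0_def cs_def r0_def rs_def)+
  define ls where "ls = map last cs"
  have H: "H = (\<lambda>x. fraction_eval N D x)"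
    using assms(3) by simp
  have len: "length rs = length cs" "n = Suc (length cs)"
    using assms(4,5) by (simp_all add: cpts rpts)
  have vars: "mp_vars N \<subseteq> {..<n}" "mp_vars D \<subseteq> {..<n}"
    using assms(2) by (auto simp: reduced_fraction_def)
  have dist: "distinct (c0 @ r0)" "\<And>l. l < length cs \<Longrightarrow> distinct (cs ! l @ rs ! l)"
    using assms(6)[of 0] assms(6)[of "Suc l" for l] assms(1) len by (auto simp: cpts rpts)
  have deg: "fraction_degree 0 N D < length c0" "\<And>l. l < length cs \<Longrightarrow> fraction_degree (Suc l) N D < length (cs ! l)"
    using assms(8)[of 0] assms(8)[of "Suc l" for l] assms(1) len by (auto simp: cpts)
  \<comment> \<open>Having more column points than the degree makes every list nonempty, so
    \<open>last\<close> yields a genuine column point.\<close>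
  have ne: "[] \<notin> set cs"
    using deg(2) by (metis in_set_conv_nth length_0_conv not_less_zero)
  have ls: "ls \<in> set (product_lists cs)"
    using last_product_lists[OF ne] last_in_set unfolding ls_def by metis
  have hd: "c0 ! 0 \<in> set c0"
    using deg(1) by (intro nth_mem) linarith
  \<comment> \<open>Mixed points are included: the blocks combine a column value of the first
    variable with row tuples of the others, and the one-variable problem combines row values with
    \<open>ls\<close>.\<close>
  have nz: "mp_eval D (t # y) \<noteq> 0"
    if "t \<in> set c0 \<union> set r0" "y \<in> set (product_lists cs) \<union> set (product_lists rs)" for t y
  proof (rule assms(7))
    show "length (t # y) = n"
      using that(2) len assms(1) by (auto dest: product_lists_nth(1))
    fix l assume "l < n"
    then show "(t # y) ! l \<in> set (cpts ! l) \<union> set (rpts ! l)"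
      using that len product_lists_nth(2)[of y cs "l - 1"] product_lists_nth(2)[of y rs "l - 1"]
      by (cases l) (auto simp: cpts rpts)
  qed

  let ?v1 = "bary_vec (\<lambda>y. mp_eval D (y @ ls)) [c0]"
  have "length ls = length cs"
    by (simp add: ls_def)
  moreover have "mp_eval D (x @ ls) \<noteq> 0" if "x \<in> set (product_lists [c0]) \<union> set (product_lists [r0])" for x
    using that nz ls by auto
  ultimately have "?v1 \<in> mat_kernel (loewner (\<lambda>x. H (x @ ls)) [c0] [r0])"
    using bary_vec_in_kernel_loewner[of N "[]" "[c0]" ls D "[r0]"] vars dist(1) deg(1) len
    by (simp add: H)
  moreover have "?v1 \<noteq> 0\<^sub>v (length (product_lists [c0]))"
    using hd nz[of "c0 ! 0" ls] ls by (intro bary_vec_nonzero[of "[c0 ! 0]"]) auto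
  ultimately obtain a where a: "a \<noteq> 0" "c1 = a \<cdot>\<^sub>v ?v1"
    using spans_kernel_smult[OF assms(12)] by (auto simp: c0_def cs_def r0_def ls_def)
  have c1: "c1 $ j = a * bary_weight [c0] [c0 ! j] * mp_eval D (c0 ! j # ls)" if "j < length c0" for j
    using that by (simp add: a bary_vec_def vec_of_list_index concat_map_singleton del: vec_of_list_map)

  \<comment> \<open>The weight of the last grid point of the remaining variables is the same for all
    blocks.\<close>
  define w where "w = bary_weight cs ls"
  have "w \<noteq> 0"
    by (simp add: w_def bary_weight_nonzero)
  \<comment> \<open>Last entry 1 forces \<open>c j\<close> to be the barycentric vector divided by
    \<open>w * D(c0 ! j # ls)\<close>. The value of \<open>D\<close> cancels against the one in
    \<open>c1 $ j\<close>, and the only factor left that depends on \<open>j\<close> is the weight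
    of \<open>c0 ! j\<close>.\<close>
  have block: "(c1 $ j) \<cdot>\<^sub>v c j = (a / w * bary_weight [c0] [c0 ! j]) \<cdot>\<^sub>v bary_vec (\<lambda>y. mp_eval D (c0 ! j # y)) cs"
    if j: "j < length c0" for j
  proof -
    let ?v = "bary_vec (\<lambda>y. mp_eval D (c0 ! j # y)) cs"
    have "?v \<in> mat_kernel (loewner (\<lambda>x. H (c0 ! j # x)) cs rs)"
      using bary_vec_in_kernel_loewner[of N "[c0 ! j]" cs "[]" D rs] vars dist(2) deg(2) nz[of "c0 ! j"] j len assms(1)
      by (simp add: H)
    moreover have "?v \<noteq> 0\<^sub>v (length (product_lists cs))"
      using nz[of "c0 ! j" ls] ls j by (intro bary_vec_nonzero[of ls]) auto
    ultimately obtain b where b: "c j = b \<cdot>\<^sub>v ?v"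
      using spans_kernel_smult[OF assms(13)[of j]] j by (auto simp: c0_def cs_def rs_def)
    have "dim_vec ?v = length (product_lists cs)"
      by (simp add: bary_vec_def del: vec_of_list_map)
    moreover have "product_lists cs \<noteq> []"
      using ls by auto
    ultimately have "b * (w * mp_eval D (c0 ! j # ls)) = 1"
      using assms(14)[of j] j bary_vec_last[OF ne, of "\<lambda>y. mp_eval D (c0 ! j # y)"]
      by (simp add: b c0_def w_def ls_def)
    then have "mp_eval D (c0 ! j # ls) * b = 1 / w"
      using \<open>w \<noteq> 0\<close> by (simp add: nonzero_eq_divide_eq mult_ac)
    then have "c1 $ j * b = a / w * bary_weight [c0] [c0 ! j]"
      by (simp add: c1[OF j] mult.assoc)
    then show ?thesis
      by (simp only: b smult_smult_assoc)
  qed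

  let ?s = "stack_vecs (map (\<lambda>j. (c1 $ j) \<cdot>\<^sub>v c j) [0..<length c0])" and ?V = "bary_vec (mp_eval D) (c0 # cs)"
  have "map (\<lambda>j. (c1 $ j) \<cdot>\<^sub>v c j) [0..<length c0]
      = map (\<lambda>j. (a / w * bary_weight [c0] [c0 ! j]) \<cdot>\<^sub>v bary_vec (\<lambda>y. mp_eval D (c0 ! j # y)) cs) [0..<length c0]"
    by (intro map_cong refl block) simp
  then have s: "?s = (a / w) \<cdot>\<^sub>v ?V"
    by (simp only: stack_bary_vec)
  have "?V \<in> mat_kernel (loewner H (c0 # cs) (r0 # rs))"
  proof -
    have "mp_eval D x \<noteq> 0" if "x \<in> set (product_lists (c0 # cs)) \<union> set (product_lists (r0 # rs))" for x
      using that nz by auto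
    moreover have "distinct ((c0 # cs) ! l @ (r0 # rs) ! l)" "fraction_degree l N D < length ((c0 # cs) ! l)"
      if "l < length (c0 # cs)" for l
      using that dist deg by (cases l; simp)+
    ultimately show ?thesis
      using bary_vec_in_kernel_loewner[of N "[]" "c0 # cs" "[]" D "r0 # rs"] vars len assms(1)
      by (simp add: H)
  qed
  then have "?s \<in> mat_kernel (loewner H cpts rpts)"
    unfolding s cpts rpts by (rule mat_kernel_smult[rotated]) (rule carrier_matI[OF refl refl])
  moreover have "?s \<noteq> 0\<^sub>v (dim_col (loewner H cpts rpts))"
  proof
    assume "?s = 0\<^sub>v (dim_col (loewner H cpts rpts))"
    then have "(w / a) \<cdot>\<^sub>v ((a / w) \<cdot>\<^sub>v ?V) = (w / a) \<cdot>\<^sub>v 0\<^sub>v (length (product_lists (c0 # cs)))"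
      by (simp only: s cpts dim_col_loewner)
    also have "\<dots> = 0\<^sub>v (length (product_lists (c0 # cs)))"
      by (intro eq_vecI) simp_all
    finally have "?V = 0\<^sub>v (length (product_lists (c0 # cs)))"
      using a(1) \<open>w \<noteq> 0\<close> by (simp add: smult_smult_assoc)
    moreover have "?V \<noteq> 0\<^sub>v (length (product_lists (c0 # cs)))"
      using hd nz[of "c0 ! 0" ls] ls by (intro bary_vec_nonzero[of "c0 ! 0 # ls"]) auto
    ultimately show False by contradiction
  qed
  \<comment> \<open>One-dimensionality of the full kernel turns this nonzero null vector into a
    generator.\<close>
  ultimately show ?thesis
    using spans_kernelI[OF assms(9)] unfolding c0_def by simp
qed

end
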